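(* For every $\mu\in\overline{\mathcal M}$ and $P\in\mathbb R^n$, $$\lim_{T\to0^+}F_T(\mu,P)=F(\mu,P).$$
   Context: $\mathbb T^n=\mathbb R^n/\mathbb Z^n$ is the flat torus and $\overline{\mathcal M}$ is the set of Borel probability measures on $\mathbb T^n$ with the weak-* topology. For $\mu\in\overline{\mathcal M}$, $P\in\mathbb R^n$: $$F(\mu,P)=\frac12\inf_{\phi\in C^1(\mathbb T^n)}\int_{\mathbb T^n}|\nabla\phi+P|^2\,d\mu.$$ For $T>0$, $\overline{\mathcal M}_T(\mu)$ is the set of weak-* continuous curves $\hat\mu=(\mu_{(t)})_{t\in[0,T]}$ in $\overline{\mathcal M}$ with $\mu_{(0)}=\mu_{(T)}=\mu$. For such a curve, $$F(\hat\mu,P,T)=\frac1T\inf_{\phi}\int_0^T\!\!\int_{\mathbb T^n}\Big[\frac{\partial\phi}{\partial t}+\frac12|\nabla_x\phi+P|^2\Big]d\mu_{(t)}\,dt\in[-\infty,\infty),$$ the infimum being over $\phi\in C^1_0(\mathbb T^n\times(0,T))$ ($C^1$ functions compactly supported in $\mathbb T^n\times(0,T)$), and $F_T(\mu,P)=\sup_{\hat\mu\in\overline{\mathcal M}_T(\mu)}F(\hat\mu,P,T)$. *)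

theory Defs
  imports "HOL-Probability.Probability"
begin

quotient_type (overloaded) 'n torus = "real ^ 'n" / "\<lambda>x y. \<forall>i. x $ i - y $ i \<in> \<int>"
  morphisms rep_torus to_torus
proof (rule equivpI)
  show "reflp (\<lambda>x y :: real ^ 'n. \<forall>i. x $ i - y $ i \<in> \<int>)"
    by (simp add: reflp_def)
  show "symp (\<lambda>x y :: real ^ 'n. \<forall>i. x $ i - y $ i \<in> \<int>)"
    unfolding symp_def by (metis Ints_minus minus_diff_eq)
  show "transp (\<lambda>x y :: real ^ 'n. \<forall>i. x $ i - y $ i \<in> \<int>)"
    unfolding transp_def by (metis Ints_add diff_add_cancel add_diff_eq)
qed

instantiation torus :: (finite) topological_space
begin

definition open_torus :: "'a torus set \<Rightarrow> bool"
  where "open_torus U \<longleftrightarrow> open (to_torus -` U)"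

instance
proof
  show "open (UNIV :: 'a torus set)"
    by (simp add: open_torus_def)
  show "open (S \<inter> T)" if "open S" "open T" for S T :: "'a torus set"
    using that by (simp add: open_torus_def open_Int)
  show "open (\<Union>K)" if "\<forall>S\<in>K. open S" for K :: "'a torus set set"
    using that by (auto simp: open_torus_def vimage_Union)
qed

end

definition C1_fun :: "('a::real_inner \<Rightarrow> real) \<Rightarrow> bool"
  where "C1_fun f \<longleftrightarrow> (\<exists>g. continuous_on UNIV g \<and> (\<forall>x. GDERIV f x :> g x))"

definition gradient :: "('a::real_inner \<Rightarrow> real) \<Rightarrow> 'a \<Rightarrow> 'a"
  where "gradient f x = (THE D. GDERIV f x :> D)"

text \<open>Smoothness on the torus is smoothness of the periodic lift; the gradient of the lift is
  periodic too, so the representative chosen by \<^const>\<open>rep_torus\<close> is immaterial.\<close>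

definition C1_torus :: "('n::finite torus \<Rightarrow> real) set"
  where "C1_torus = {\<phi>. C1_fun (\<lambda>x. \<phi> (to_torus x))}"

definition torus_grad :: "('n::finite torus \<Rightarrow> real) \<Rightarrow> 'n torus \<Rightarrow> real ^ 'n"
  where "torus_grad \<phi> q = gradient (\<lambda>x. \<phi> (to_torus x)) (rep_torus q)"

text \<open>A compactly supported function on the product of the torus with the interval from 0 to
  \<open>T\<close> is identified with its extension by zero to all times.\<close>

definition C1_compact_support :: "real \<Rightarrow> ('n::finite torus \<times> real \<Rightarrow> real) set"
  where "C1_compact_support T =
    {\<phi>. C1_fun (\<lambda>(x, t). \<phi> (to_torus x, t)) \<and>
        compact (closure {p. \<phi> p \<noteq> 0}) \<and>
        closure {p. \<phi> p \<noteq> 0} \<subseteq> UNIV \<times> {0<..<T}}"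

definition prob_measures :: "'n::finite torus measure set"
  where "prob_measures = {\<mu>. prob_space \<mu> \<and> sets \<mu> = sets borel}"

text \<open>The coarsest topology making integration against every continuous function continuous.
  The torus is compact, so these test functions are bounded.\<close>

definition weak_star_topology :: "'n::finite torus measure topology"
  where "weak_star_topology = topology_generated_by
    {{\<mu> \<in> prob_measures. (LINT x|\<mu>. f x) \<in> U} | (f :: 'n torus \<Rightarrow> real) U.
       continuous_on UNIV f \<and> open U}"

text \<open>Only the restriction of a curve to the interval from 0 to \<open>T\<close> is relevant.\<close>

definition closed_curves :: "real \<Rightarrow> 'n::finite torus measure \<Rightarrow> (real \<Rightarrow> 'n torus measure) set"
  where "closed_curves T \<mu> =
    {m. continuous_map (top_of_set {0..T}) weak_star_topology m \<and> m 0 = \<mu> \<and> m T = \<mu>}"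

definition F_stat :: "'n::finite torus measure \<Rightarrow> real ^ 'n \<Rightarrow> real"
  where "F_stat \<mu> P = 1 / 2 * (INF \<phi>\<in>C1_torus. LINT x|\<mu>. (norm (torus_grad \<phi> x + P))\<^sup>2)"

definition F_curve :: "(real \<Rightarrow> 'n::finite torus measure) \<Rightarrow> real ^ 'n \<Rightarrow> real \<Rightarrow> ereal"
  where "F_curve m P T = ereal (1 / T) *
    (INF \<phi>\<in>C1_compact_support T. ereal (LINT t:{0..T}|lborel. LINT x|m t.
       deriv (\<lambda>s. \<phi> (x, s)) t + 1 / 2 * (norm (torus_grad (\<lambda>y. \<phi> (y, t)) x + P))\<^sup>2))"

definition F_period :: "real \<Rightarrow> 'n::finite torus measure \<Rightarrow> real ^ 'n \<Rightarrow> ereal"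
  where "F_period T \<mu> P = (SUP m\<in>closed_curves T \<mu>. F_curve m P T)"

end

theory Submission
  imports Defs
begin

text \<open>For the lower bound, test the period functional with the constant curve: the term
  \<open>\<partial>\<phi>/\<partial>t\<close> integrates to zero and each time slice of \<open>\<phi>\<close> competes in the stationary problem.

  For the upper bound, take a near-minimiser \<open>\<phi>\<^sub>0\<close> of the stationary problem and, by
  Stone--Weierstrass, a \<open>C\<^sup>1\<close> function \<open>\<psi>\<close> uniformly close to
  \<open>1/2 |\<nabla>\<phi>\<^sub>0 + P|\<^sup>2\<close>. Up to a cutoff near the times \<open>0\<close> and \<open>T\<close>, the test function
  \<open>\<phi>\<^sub>0 + (T - t) \<psi>\<close> has action density \<open>- \<psi> + 1/2 |\<nabla>\<phi>\<^sub>0 + P|\<^sup>2 + O(T)\<close>, which is small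
  everywhere on the torus. Since the curve starts and ends at \<open>\<mu>\<close>, the cutoff contributes
  \<open>T \<integral>\<psi> d\<mu>\<close>, so after division by \<open>T\<close> the bound is uniform over all closed curves.\<close>

section \<open>The torus and its continuously differentiable functions\<close>

lemma to_torus_eq_iff: "to_torus x = to_torus y \<longleftrightarrow> (\<forall>i. x $ i - y $ i \<in> \<int>)"
  by (rule torus.abs_eq_iff)

lemma to_torus_rep_torus [simp]: "to_torus (rep_torus q) = q"
  by (rule Quotient_abs_rep [OF Quotient_torus])

lemma continuous_to_torus: "continuous_on S to_torus"
proof (rule continuous_on_subset)
  show "continuous_on UNIV (to_torus :: real ^ 'n \<Rightarrow> 'n::finite torus)"
    by (simp add: continuous_on_open_vimage open_torus_def)
qed simp

lemma continuous_on_torus_iff: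
  fixes f :: "'n::finite torus \<Rightarrow> 'b::topological_space"
  shows "continuous_on UNIV f \<longleftrightarrow> continuous_on UNIV (\<lambda>x. f (to_torus x))"
  by (simp add: continuous_on_open_vimage open_torus_def vimage_def)

text \<open>A compact set meeting every class. Boundary points represent some classes repeatedly,
  which is harmless because only surjectivity onto the torus matters.\<close>

definition unit_cube :: "(real ^ 'n::finite) set"
  where "unit_cube = cbox 0 1"

lemma compact_unit_cube: "compact unit_cube"
  by (simp add: unit_cube_def)

lemma torus_eq_image_cube: "\<exists>y\<in>unit_cube. q = to_torus y"
proof
  \<comment> \<open>Passing to fractional parts changes each coordinate by its floor, an
    integer.\<close>
  let ?y = "\<chi> i. frac (rep_torus q $ i)"
  show "?y \<in> unit_cube"
    by (simp add: unit_cube_def mem_box_cart frac_lt_1 less_imp_le)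
  have "to_torus (rep_torus q) = to_torus ?y"
    by (simp only: to_torus_eq_iff) (simp add: frac_def)
  then show "q = to_torus ?y"
    by simp
qed

lemma compact_torus: "compact (UNIV :: 'n::finite torus set)"
proof -
  have "UNIV = to_torus ` (unit_cube :: (real ^ 'n) set)"
    using torus_eq_image_cube by blast
  then show ?thesis
    by (metis compact_continuous_image compact_unit_cube continuous_to_torus)
qed

section \<open>Gradients of periodic lifts\<close>

lemma GDERIV_unique: "GDERIV f x :> D \<Longrightarrow> GDERIV f x :> E \<Longrightarrow> D = E"
  unfolding gderiv_def
  by (metis has_derivative_unique inner_commute vector_eq_ldot)

lemma gradient_eqI: "GDERIV f x :> D \<Longrightarrow> gradient f x = D"
  unfolding gradient_def by (blast intro: GDERIV_unique)

text \<open>Uniqueness of gradients forces the existentially quantified \<open>g\<close> to be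
  \<open>gradient f\<close>, so continuity can be stated for a canonical function.\<close>

lemma C1_fun_alt: "C1_fun f \<longleftrightarrow> (\<forall>x. GDERIV f x :> gradient f x) \<and> continuous_on UNIV (gradient f)"
proof
  assume "C1_fun f"
  then obtain g where g: "continuous_on UNIV g" "\<And>x. GDERIV f x :> g x"
    by (auto simp: C1_fun_def)
  then have "gradient f = g"
    by (auto intro: gradient_eqI)
  with g show "(\<forall>x. GDERIV f x :> gradient f x) \<and> continuous_on UNIV (gradient f)"
    by simp
qed (auto simp: C1_fun_def)

lemma GDERIV_shift:
  assumes "GDERIV f (x + a) :> D"
  shows "GDERIV (\<lambda>y. f (y + a)) x :> D"
  unfolding gderiv_def
  by (rule has_derivative_compose [where f = "\<lambda>y. y + a" and f' = "\<lambda>y. y" and g = f, OF _ assms [unfolded gderiv_def]])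
    (auto intro!: derivative_eq_intros)

text \<open>The vector \<open>y - x\<close> has integer coordinates, so the lift is invariant under
  translation by it, and so is its derivative. This makes \<open>torus_grad\<close> independent of
  the representative.\<close>

lemma gradient_lift_cong:
  assumes "C1_fun (\<lambda>x. \<phi> (to_torus x))" "to_torus x = to_torus y"
  shows "gradient (\<lambda>x. \<phi> (to_torus x)) x = gradient (\<lambda>x. \<phi> (to_torus x)) y"
proof -
  have "to_torus (z + (y - x)) = to_torus z" for z
    using assms(2) by (simp only: to_torus_eq_iff) (simp add: Ints_minus [of "_ - _", simplified])
  then have "GDERIV (\<lambda>x. \<phi> (to_torus x)) x :> gradient (\<lambda>x. \<phi> (to_torus x)) y"
    using GDERIV_shift [of "\<lambda>x. \<phi> (to_torus x)" x "y - x"] assms(1) by (simp add: C1_fun_alt)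
  then show ?thesis
    by (rule gradient_eqI)
qed

lemma torus_grad_to_torus:
  "\<phi> \<in> C1_torus \<Longrightarrow> torus_grad \<phi> (to_torus x) = gradient (\<lambda>x. \<phi> (to_torus x)) x"
  unfolding torus_grad_def C1_torus_def by (rule gradient_lift_cong) auto

lemma GDERIV_lift:
  "\<phi> \<in> C1_torus \<Longrightarrow> GDERIV (\<lambda>x. \<phi> (to_torus x)) x :> torus_grad \<phi> (to_torus x)"
  by (simp add: torus_grad_to_torus) (simp add: C1_torus_def C1_fun_alt)

lemma continuous_on_torus_grad: "\<phi> \<in> C1_torus \<Longrightarrow> continuous_on UNIV (torus_grad \<phi>)"
  unfolding continuous_on_torus_iff
  by (simp add: torus_grad_to_torus) (simp add: C1_torus_def C1_fun_alt)

lemma C1_torusI: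
  assumes "\<And>x. GDERIV (\<lambda>x. \<phi> (to_torus x)) x :> g x" "continuous_on UNIV g"
  shows "\<phi> \<in> C1_torus"
  using assms by (auto simp: C1_torus_def C1_fun_def)

lemma GDERIV_imp_continuous: "(\<And>x. GDERIV f x :> g x) \<Longrightarrow> continuous_on UNIV f"
  by (metis continuous_at_imp_continuous_on gderiv_def has_derivative_continuous)

lemma continuous_on_C1_torus: "\<phi> \<in> C1_torus \<Longrightarrow> continuous_on UNIV \<phi>"
  unfolding continuous_on_torus_iff by (rule GDERIV_imp_continuous) (rule GDERIV_lift)

lemma continuous_on_lift: "continuous_on UNIV f \<Longrightarrow> continuous_on UNIV (\<lambda>x. f (to_torus x))"
  by (simp add: continuous_on_torus_iff)

section \<open>The algebra of continuously differentiable functions and its density\<close>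

lemma C1_torus_const: "(\<lambda>_. c) \<in> C1_torus"
  by (rule C1_torusI [where g = "\<lambda>_. 0"]) (auto intro: GDERIV_const)

lemma C1_torus_add: "\<phi> \<in> C1_torus \<Longrightarrow> \<psi> \<in> C1_torus \<Longrightarrow> (\<lambda>x. \<phi> x + \<psi> x) \<in> C1_torus"
  by (rule C1_torusI, rule GDERIV_add)
    (auto intro: GDERIV_lift intro!: continuous_intros continuous_on_lift continuous_on_torus_grad)

lemma C1_torus_mult: "\<phi> \<in> C1_torus \<Longrightarrow> \<psi> \<in> C1_torus \<Longrightarrow> (\<lambda>x. \<phi> x * \<psi> x) \<in> C1_torus"
  by (rule C1_torusI, rule GDERIV_mult)
    (auto intro: GDERIV_lift intro!: continuous_intros continuous_on_lift continuous_on_torus_grad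
      continuous_on_C1_torus)

text \<open>Distinct classes have representatives differing by a non-integer in some coordinate
  \<open>i\<close>. A cosine of period 1 in that coordinate, with its maximum at
  \<open>x $ i\<close>, tells them apart.\<close>

lemma C1_torus_separates:
  fixes p q :: "'n::finite torus"
  assumes "p \<noteq> q"
  shows "\<exists>f\<in>C1_torus. f p \<noteq> f q"
proof -
  obtain x y where xy: "p = to_torus x" "q = to_torus y"
    by (metis to_torus_rep_torus)
  with assms obtain i where i: "y $ i - x $ i \<notin> \<int>"
    by (metis to_torus_eq_iff)
  define f where "f = (\<lambda>p :: 'n torus. cos (2 * pi * (rep_torus p $ i - x $ i)))"
  \<comment> \<open>Another representative shifts the angle by a multiple of \<open>2 * pi\<close>,
    so the cosine may be evaluated at any \<open>z\<close> in the class.\<close>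
  have f: "f (to_torus z) = cos (2 * pi * (z $ i - x $ i))" for z
  proof -
    have "rep_torus (to_torus z) $ i - z $ i \<in> \<int>"
      using to_torus_eq_iff [of "rep_torus (to_torus z)" z] by simp
    then obtain k where "rep_torus (to_torus z) $ i = z $ i + of_int k"
      by (metis Ints_cases add_diff_cancel_left' diff_add_cancel add.commute)
    moreover have "2 * pi * (z $ i + of_int k - x $ i) =
        2 * pi * (z $ i - x $ i) + 2 * pi * of_int k"
      by (simp add: algebra_simps)
    ultimately show ?thesis
      by (simp add: f_def cos_add)
  qed
  have "f \<in> C1_torus"
  proof (rule C1_torusI)
    show "GDERIV (\<lambda>z. f (to_torus z)) z :>
        (- sin (2 * pi * (z $ i - x $ i)) * (2 * pi)) *\<^sub>R axis i 1" for z
      unfolding f gderiv_def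
      by (auto intro!: derivative_eq_intros bounded_linear_imp_has_derivative bounded_linear_vec_nth simp: inner_axis)
  qed (intro continuous_intros)
  moreover have "f p = 1"
    by (simp add: xy f)
  moreover have "f q \<noteq> 1"
  \<comment> \<open>The cosine equals 1 only at multiples of \<open>2 * pi\<close>, which would make
    \<open>y $ i - x $ i\<close> an integer.\<close>
  proof
    assume "f q = 1"
    then obtain n where "2 * pi * (y $ i - x $ i) = of_int n * 2 * pi"
      using cos_one_2pi_int by (auto simp: xy f)
    then have "y $ i - x $ i = of_int n"
      by simp
    with i show False
      by simp
  qed
  ultimately show ?thesis
    by metis
qed

text \<open>Disjoint neighbourhoods are pulled back from the real line along a separating function.
  The Hausdorff property is what the Stone-Weierstrass locale below asks of its space.\<close>

instance torus :: (finite) t2_space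
proof
  fix p q :: "'a torus"
  assume "p \<noteq> q"
  then obtain f where f: "f \<in> C1_torus" "f p \<noteq> f q"
    using C1_torus_separates by blast
  obtain U V where "open U" "open V" "f p \<in> U" "f q \<in> V" "U \<inter> V = {}"
    using hausdorff [OF f(2)] by blast
  moreover have "open (f -` W)" if "open W" for W
    using continuous_on_C1_torus [OF f(1)] that by (simp add: continuous_on_open_vimage)
  ultimately show "\<exists>U V. open U \<and> open V \<and> p \<in> U \<and> q \<in> V \<and> U \<inter> V = {}"
    by (intro exI [of _ "f -` U"] exI [of _ "f -` V"]) auto
qed

text \<open>Stone-Weierstrass: \<open>C1_torus\<close> contains the constants, is closed under sums
  and products, and separates the points of a compact space.\<close>

lemma C1_torus_dense:
  fixes f :: "'n::finite torus \<Rightarrow> real"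
  assumes "continuous_on UNIV f" "e > 0"
  shows "\<exists>g\<in>C1_torus. \<forall>x. \<bar>f x - g x\<bar> < e"
proof -
  interpret function_ring_on "C1_torus :: ('n torus \<Rightarrow> real) set" UNIV
    by unfold_locales
      (auto intro: compact_torus continuous_on_C1_torus C1_torus_add C1_torus_mult C1_torus_const
        C1_torus_separates)
  show ?thesis
    using Stone_Weierstrass_basic [OF assms] by simp
qed

section \<open>Integrals along curves of measures\<close>

lemma prob_measuresD:
  assumes "\<mu> \<in> prob_measures"
  shows "prob_space \<mu>" "sets \<mu> = sets borel" "space \<mu> = UNIV"
  using assms sets_eq_imp_space_eq [of \<mu> borel] by (auto simp: prob_measures_def)

lemma continuous_on_torus_bounded:
  fixes f :: "'n::finite torus \<Rightarrow> 'b::real_normed_vector"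
  assumes "continuous_on UNIV f"
  shows "\<exists>B. \<forall>x. norm (f x) \<le> B"
  using compact_imp_bounded [OF compact_continuous_image [OF assms compact_torus]]
  by (auto simp: bounded_iff)

lemma integrable_continuous_torus:
  fixes f :: "'n::finite torus \<Rightarrow> real"
  assumes "\<mu> \<in> prob_measures" "continuous_on UNIV f"
  shows "integrable \<mu> f"
proof -
  interpret prob_space \<mu>
    using prob_measuresD assms(1) by blast
  obtain B where "\<And>x. norm (f x) \<le> B"
    using continuous_on_torus_bounded [OF assms(2)] by blast
  moreover have "f \<in> borel_measurable \<mu>"
    using borel_measurable_continuous_onI [OF assms(2)] prob_measuresD(2) [OF assms(1)]
    by (simp cong: measurable_cong_sets)
  ultimately show ?thesis
    by (intro integrable_const_bound [of _ B]) auto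
qed

lemma abs_integral_torus_le:
  fixes f :: "'n::finite torus \<Rightarrow> real"
  assumes "\<mu> \<in> prob_measures" "continuous_on UNIV f" "\<And>x. \<bar>f x\<bar> \<le> B"
  shows "\<bar>LINT x|\<mu>. f x\<bar> \<le> B"
proof -
  interpret prob_space \<mu>
    using prob_measuresD assms(1) by blast
  have "integrable \<mu> f"
    using assms integrable_continuous_torus by blast
  then have "(LINT x|\<mu>. f x) \<le> B" "(LINT x|\<mu>. - f x) \<le> B"
    using assms(3) by (intro integral_le_const; force simp: abs_le_iff)+
  then show ?thesis
    by simp
qed

lemma openin_weak_star:
  fixes f :: "'n::finite torus \<Rightarrow> real"
  assumes "continuous_on UNIV f" "open U"
  shows "openin weak_star_topology {\<mu> \<in> prob_measures. (LINT x|\<mu>. f x) \<in> U}"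
  unfolding weak_star_topology_def using assms by (intro topology_generated_by_Basis) auto

lemma topspace_weak_star: "topspace weak_star_topology = prob_measures"
proof
  show "topspace weak_star_topology \<subseteq> prob_measures"
    by (auto simp: weak_star_topology_def)
  show "prob_measures \<subseteq> topspace weak_star_topology"
    \<comment> \<open>With the test function 0 and the open set \<open>UNIV\<close>, a generating
      set is already all of \<open>prob_measures\<close>.\<close>
    using openin_subset [OF openin_weak_star [of "\<lambda>_. 0" UNIV]] by simp
qed

lemma closed_curvesD:
  fixes f :: "'n::finite torus \<Rightarrow> real"
  assumes "m \<in> closed_curves T \<mu>"
  shows closed_curves_prob: "t \<in> {0..T} \<Longrightarrow> m t \<in> prob_measures"
    and closed_curves_continuous:
      "continuous_on UNIV f \<Longrightarrow> continuous_on {0..T} (\<lambda>t. LINT x|m t. f x)"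
    and closed_curves_ends: "m 0 = \<mu>" "m T = \<mu>"
proof -
  have m: "continuous_map (top_of_set {0..T}) weak_star_topology m"
    using assms by (simp add: closed_curves_def)
  show prob: "m t \<in> prob_measures" if "t \<in> {0..T}" for t
    using continuous_map_image_subset_topspace [OF m] that
    by (auto simp: topspace_weak_star)
  show "continuous_on {0..T} (\<lambda>t. LINT x|m t. f x)" if f: "continuous_on UNIV f"
    unfolding continuous_openin_preimage_eq
  proof (intro allI impI)
    fix U :: "real set"
    assume "open U"
    \<comment> \<open>The subbasic set pulls back to the required preimage; its clause
      \<open>\<mu> \<in> prob_measures\<close> holds along the whole curve by
      \<open>prob\<close>.\<close>
    from openin_continuous_map_preimage [OF m openin_weak_star [OF f this]]
    show "openin (top_of_set {0..T}) ({0..T} \<inter> (\<lambda>t. LINT x|m t. f x) -` U)"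
      by (rule back_subst [of "openin _"]) (use prob in auto)
  qed
  show "m 0 = \<mu>" "m T = \<mu>"
    using assms by (auto simp: closed_curves_def)
qed

lemma const_closed_curve: "\<mu> \<in> prob_measures \<Longrightarrow> (\<lambda>_. \<mu>) \<in> closed_curves T \<mu>"
  by (simp add: closed_curves_def topspace_weak_star)

section \<open>Time-dependent integrands\<close>

text \<open>Heine-Cantor is applied to the lift on the compact product of \<open>unit_cube\<close>
  and \<open>I\<close>. Every point has one representative in the cube that serves for both times,
  hence \<open>d\<close> does not depend on \<open>x\<close>.\<close>

lemma uniformly_continuous_in_time:
  fixes G :: "'n::finite torus \<Rightarrow> real \<Rightarrow> real"
  assumes "continuous_on UNIV (\<lambda>(y, t). G (to_torus y) t)" "compact I" "e > 0"
  obtains d where "d > 0" "\<And>x s t. s \<in> I \<Longrightarrow> t \<in> I \<Longrightarrow> \<bar>s - t\<bar> < d \<Longrightarrow> \<bar>G x s - G x t\<bar> < e"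
proof -
  have "uniformly_continuous_on (unit_cube \<times> I) (\<lambda>(y, t). G (to_torus y) t)"
    using assms(1,2) compact_unit_cube
    by (intro compact_uniformly_continuous compact_Times) (auto elim: continuous_on_subset)
  then obtain d where "d > 0" and d: "\<And>y s z t. y \<in> unit_cube \<Longrightarrow> z \<in> unit_cube \<Longrightarrow> s \<in> I \<Longrightarrow> t \<in> I \<Longrightarrow>
      dist (z, t) (y, s) < d \<Longrightarrow> dist (G (to_torus z) t) (G (to_torus y) s) < e"
    using \<open>e > 0\<close> unfolding uniformly_continuous_on_def by fastforce
  have "\<bar>G x s - G x t\<bar> < e" if "s \<in> I" "t \<in> I" "\<bar>s - t\<bar> < d" for x s t
  proof -
    obtain y where "y \<in> unit_cube" "x = to_torus y"
      using torus_eq_image_cube by blast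
    then show ?thesis
      using d [of y y t s] that by (simp add: dist_Pair_Pair dist_real_def)
  qed
  with \<open>d > 0\<close> that show ?thesis
    by blast
qed

lemma continuous_on_space_slice:
  fixes G :: "'n::finite torus \<Rightarrow> real \<Rightarrow> real"
  assumes "continuous_on UNIV (\<lambda>(y, t). G (to_torus y) t)"
  shows "continuous_on UNIV (\<lambda>x. G x t)"
proof -
  have "continuous_on UNIV ((\<lambda>(y, t). G (to_torus y) t) \<circ> (\<lambda>y. (y, t)))"
    by (intro continuous_on_compose continuous_intros) (auto intro: continuous_on_subset [OF assms])
  then show ?thesis
    by (simp add: continuous_on_torus_iff o_def)
qed

text \<open>Measure and integrand vary together. First the integrand is frozen at time
  \<open>t\<close>, at a cost uniform in space and hence bounded after integration against a
  probability measure; then weak-* continuity handles the fixed integrand.\<close>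

lemma continuous_on_integral_curve:
  fixes G :: "'n::finite torus \<Rightarrow> real \<Rightarrow> real"
  assumes m: "m \<in> closed_curves T \<mu>" and G: "continuous_on UNIV (\<lambda>(y, t). G (to_torus y) t)"
  shows "continuous_on {0..T} (\<lambda>t. LINT x|m t. G x t)"
  unfolding continuous_on_iff
proof (intro ballI allI impI)
  fix t e :: real
  assume t: "t \<in> {0..T}" and "e > 0"
  obtain d where "d > 0" and
    d: "\<And>x s t. s \<in> {0..T} \<Longrightarrow> t \<in> {0..T} \<Longrightarrow> \<bar>s - t\<bar> < d \<Longrightarrow> \<bar>G x s - G x t\<bar> < e / 2"
    using uniformly_continuous_in_time [OF G, of "{0..T}" "e / 2"] \<open>e > 0\<close> by auto
  have Gt: "continuous_on UNIV (\<lambda>x. G x t)" for t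
    by (rule continuous_on_space_slice [OF G])
  have "continuous_on {0..T} (\<lambda>s. LINT x|m s. G x t)"
    by (rule closed_curves_continuous [OF m Gt])
  then obtain d' where "d' > 0" and d': "\<And>s. s \<in> {0..T} \<Longrightarrow> \<bar>s - t\<bar> < d' \<Longrightarrow>
      \<bar>(LINT x|m s. G x t) - (LINT x|m t. G x t)\<bar> < e / 2"
    using t \<open>e > 0\<close> unfolding continuous_on_iff dist_real_def by (meson half_gt_zero)
  have "\<bar>(LINT x|m s. G x s) - (LINT x|m t. G x t)\<bar> < e"
    if s: "s \<in> {0..T}" "\<bar>s - t\<bar> < min d d'" for s
  proof -
    have ms: "m s \<in> prob_measures"
      using closed_curves_prob [OF m s(1)] .
    have "\<bar>LINT x|m s. G x s - G x t\<bar> \<le> e / 2"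
      using d [OF s(1) t] s(2)
      by (intro abs_integral_torus_le [OF ms]) (auto intro!: continuous_intros Gt less_imp_le)
    then have "\<bar>(LINT x|m s. G x s) - (LINT x|m s. G x t)\<bar> \<le> e / 2"
      by (simp add: integrable_continuous_torus [OF ms Gt])
    with d' [OF s(1)] s(2) show ?thesis
      by linarith
  qed
  with \<open>d > 0\<close> \<open>d' > 0\<close>
  show "\<exists>d>0. \<forall>s\<in>{0..T}. dist s t < d \<longrightarrow> dist (LINT x|m s. G x s) (LINT x|m t. G x t) < e"
    by (intro exI [of _ "min d d'"]) (auto simp: dist_real_def)
qed

text \<open>By the mean value theorem each difference quotient is a value of \<open>D x\<close> at a
  time between \<open>t\<close> and \<open>t + h\<close>. Uniform continuity in time makes it close
  to \<open>D x t\<close> for all \<open>x\<close> at once, and integration preserves the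
  bound.\<close>

lemma DERIV_integral_torus:
  fixes \<phi> D :: "'n::finite torus \<Rightarrow> real \<Rightarrow> real"
  assumes \<mu>: "\<mu> \<in> prob_measures"
    and \<phi>: "\<And>s. continuous_on UNIV (\<lambda>x. \<phi> x s)"
    and D: "continuous_on UNIV (\<lambda>(y, t). D (to_torus y) t)"
    and deriv: "\<And>x s. (\<phi> x has_real_derivative D x s) (at s)"
  shows "((\<lambda>s. LINT x|\<mu>. \<phi> x s) has_real_derivative (LINT x|\<mu>. D x t)) (at t)"
  unfolding DERIV_def LIM_eq
proof (intro allI impI)
  fix e :: real
  assume "e > 0"
  have Dt: "continuous_on UNIV (\<lambda>x. D x t)"
    by (rule continuous_on_space_slice [OF D])
  \<comment> \<open>A compact window around \<open>t\<close> gives uniformity; this is why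
    \<open>h\<close> is also kept below 1 in modulus.\<close>
  obtain d where "d > 0" and
    d: "\<And>x s s'. s \<in> {t-1..t+1} \<Longrightarrow> s' \<in> {t-1..t+1} \<Longrightarrow> \<bar>s - s'\<bar> < d \<Longrightarrow> \<bar>D x s - D x s'\<bar> < e / 2"
    using uniformly_continuous_in_time [OF D, of "{t-1..t+1}" "e / 2"] \<open>e > 0\<close> by auto
  have "\<bar>((LINT x|\<mu>. \<phi> x (t + h)) - (LINT x|\<mu>. \<phi> x t)) / h - (LINT x|\<mu>. D x t)\<bar> < e"
    if h: "h \<noteq> 0" "\<bar>h\<bar> < min 1 d" for h
  proof -
    have "\<bar>(\<phi> x (t + h) - \<phi> x t) / h - D x t\<bar> \<le> e / 2" for x
    proof -
      have "\<exists>s. \<bar>s - t\<bar> < \<bar>h\<bar> \<and> (\<phi> x (t + h) - \<phi> x t) / h = D x s"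
      proof (cases "h > 0")
        case True
        then show ?thesis
          using MVT2 [of t "t + h" "\<phi> x" "D x"] deriv by (force simp: field_simps)
      next
        case False
        then obtain s where "t + h < s" "s < t" "\<phi> x t - \<phi> x (t + h) = (t - (t + h)) * D x s"
          using MVT2 [of "t + h" t "\<phi> x" "D x"] deriv h(1) by force
        then show ?thesis
          using h(1) by (intro exI [of _ s]) (auto simp: field_simps)
      qed
      then obtain s where s: "\<bar>s - t\<bar> < \<bar>h\<bar>" "(\<phi> x (t + h) - \<phi> x t) / h = D x s"
        by blast
      then show ?thesis
        using d [of s t x] h(2) by (auto simp: abs_if split: if_splits)
    qed
    then have "\<bar>LINT x|\<mu>. (\<phi> x (t + h) - \<phi> x t) / h - D x t\<bar> \<le> e / 2"
      using h(1) by (intro abs_integral_torus_le [OF \<mu>] continuous_intros \<phi> Dt) auto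
    then show ?thesis
      using \<open>e > 0\<close> by (simp add: integrable_continuous_torus [OF \<mu>] \<phi> Dt)
  qed
  with \<open>d > 0\<close> show "\<exists>s>0. \<forall>h. h \<noteq> 0 \<and> norm (h - 0) < s \<longrightarrow>
      norm (((LINT x|\<mu>. \<phi> x (t + h)) - (LINT x|\<mu>. \<phi> x t)) / h - (LINT x|\<mu>. D x t)) < e"
    by (intro exI [of _ "min 1 d"]) auto
qed

section \<open>Cutoff functions in time\<close>

lemma continuous_on_integrable_interval:
  fixes f :: "real \<Rightarrow> real"
  assumes "continuous_on {a..b} f"
  shows "set_integrable lborel {a..b} f"
  by (rule borel_integrable_atLeastAtMost' [OF assms])

lemma set_integral_FTC:
  fixes F f :: "real \<Rightarrow> real"
  assumes "a \<le> b" "\<And>t. (F has_real_derivative f t) (at t)" "continuous_on {a..b} f"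
  shows "(LINT t:{a..b}|lborel. f t) = F b - F a"
  unfolding set_lebesgue_integral_def
  using assms
  by (intro integral_FTC_atLeastAtMost)
    (auto simp: has_real_derivative_iff_has_vector_derivative [symmetric] intro: has_field_derivative_at_within)

lemma set_integral_mono_continuous:
  fixes f g :: "real \<Rightarrow> real"
  assumes "continuous_on {a..b} f" "continuous_on {a..b} g" "\<And>t. t \<in> {a..b} \<Longrightarrow> f t \<le> g t"
  shows "(LINT t:{a..b}|lborel. f t) \<le> (LINT t:{a..b}|lborel. g t)"
  using assms by (intro set_integral_mono continuous_on_integrable_interval)

text \<open>Squaring the positive part removes its corner, which gives the quadratic spline
  \<open>step\<close> a continuous derivative.\<close>

lemma DERIV_pos_part_square:
  "((\<lambda>u::real. (max 0 (u - c))\<^sup>2) has_real_derivative 2 * max 0 (u - c)) (at u)"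
proof -
  have "((\<lambda>u::real. (max 0 u)\<^sup>2) has_real_derivative 2 * max 0 u) (at u)" for u
  proof -
    consider "u < 0" | "u = 0" | "u > 0"
      by linarith
    then show ?thesis
    proof cases
      case 1
      have "((\<lambda>_. 0) has_real_derivative 2 * max 0 u) (at u)"
        using 1 by simp
      then show ?thesis
        by (rule has_field_derivative_transform_within_open [of _ _ _ "{..<0}"]) (use 1 in auto)
    next
      case 2
      \<comment> \<open>At the junction the difference quotient is \<open>h\<close> for positive
        \<open>h\<close> and 0 otherwise, so its modulus is at most that of
        \<open>h\<close>.\<close>
      have "(\<lambda>h::real. (max 0 h)\<^sup>2 / h) \<midarrow>0\<rightarrow> 0"
      proof (rule LIM_I, intro exI conjI allI impI)
        fix r h :: real
        assume "0 < r" "h \<noteq> 0 \<and> norm (h - 0) < r"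
        then show "norm ((max 0 h)\<^sup>2 / h - 0) < r"
          by (auto simp: max_def power2_eq_square)
      qed auto
      with 2 show ?thesis
        by (simp add: DERIV_def)
    next
      case 3
      have "((\<lambda>u. u\<^sup>2) has_real_derivative 2 * max 0 u) (at u)"
        using 3 by (auto intro!: derivative_eq_intros)
      then show ?thesis
        by (rule has_field_derivative_transform_within_open [of _ _ _ "{0<..}"]) (use 3 in auto)
    qed
  qed
  from this [of "u + - c"] show ?thesis
    using DERIV_shift [of "\<lambda>u. (max 0 u)\<^sup>2" _ u "- c"] by simp
qed

text \<open>A continuously differentiable step: its derivative is the tent on the unit interval with
  peak at \<open>1/2\<close> and total mass \<open>1\<close>.\<close>

definition step :: "real \<Rightarrow> real"
  where "step u = 2 * (max 0 (u - 0))\<^sup>2 - 4 * (max 0 (u - 1/2))\<^sup>2 + 2 * (max 0 (u - 1))\<^sup>2"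

definition tent :: "real \<Rightarrow> real"
  where "tent u = 4 * max 0 (u - 0) - 8 * max 0 (u - 1/2) + 4 * max 0 (u - 1)"

lemma DERIV_step: "(step has_real_derivative tent u) (at u)"
  unfolding step_def [abs_def] tent_def
  \<comment> \<open>The summand written with \<open>u - 0\<close> gives all three terms the shape of
    \<open>DERIV_pos_part_square\<close>.\<close>
  by (rule derivative_eq_intros DERIV_pos_part_square refl)+ simp

lemma tent_nonneg: "0 \<le> tent u" and tent_eq_0: "u \<notin> {0..1} \<Longrightarrow> tent u = 0"
  by (auto simp: tent_def max_def)

lemma step_eq_0: "u \<le> 0 \<Longrightarrow> step u = 0" and step_eq_1: "u \<ge> 1 \<Longrightarrow> step u = 1"
  by (auto simp: step_def max_def power2_eq_square algebra_simps)

lemma step_mono: "u \<le> v \<Longrightarrow> step u \<le> step v"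
  using DERIV_nonneg_imp_nondecreasing [of u v step] DERIV_step tent_nonneg by blast

lemma step_nonneg: "0 \<le> step u" and step_le_1: "step u \<le> 1"
  using step_mono [of "min u 0" u] step_mono [of u "max u 1"]
  by (auto simp: step_eq_0 step_eq_1)

text \<open>The function \<open>\<eta>\<close> is a step up near 0 minus a step up near
  \<open>T\<close>. Its derivative is a nonnegative bump of mass 1 near 0 minus another near
  \<open>T\<close>, so integrating against it approximates \<open>K 0 - K T\<close>.\<close>

lemma cutoff:
  fixes K :: "real \<Rightarrow> real"
  assumes "T > 0" "e > 0" and K: "continuous_on {0..T} K"
  obtains \<eta> \<eta>' a b where "\<And>t. (\<eta> has_real_derivative \<eta>' t) (at t)" "continuous_on UNIV \<eta>'"
    "\<And>t. 0 \<le> \<eta> t" "\<And>t. \<eta> t \<le> 1" "0 < a" "b < T" "\<And>t. t \<notin> {a..b} \<Longrightarrow> \<eta> t = 0"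
    "(LINT t:{0..T}|lborel. \<eta>' t * K t) \<le> K 0 - K T + e"
proof -
  obtain d0 where d0: "d0 > 0" "\<And>t. t \<in> {0..T} \<Longrightarrow> \<bar>t\<bar> < d0 \<Longrightarrow> \<bar>K t - K 0\<bar> < e / 2"
    using K \<open>T > 0\<close> \<open>e > 0\<close> unfolding continuous_on_iff dist_real_def
    by (metis atLeastAtMost_iff diff_zero half_gt_zero less_imp_le order_refl)
  obtain d1 where d1: "d1 > 0" "\<And>t. t \<in> {0..T} \<Longrightarrow> \<bar>t - T\<bar> < d1 \<Longrightarrow> \<bar>K t - K T\<bar> < e / 2"
    using K \<open>T > 0\<close> \<open>e > 0\<close> unfolding continuous_on_iff dist_real_def
    by (metis atLeastAtMost_iff half_gt_zero less_imp_le order_refl)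
  \<comment> \<open>The ramps occupy \<open>{d..2 * d}\<close> and
    \<open>{T - 2 * d..T - d}\<close>. The factor 4 keeps them in order and inside the windows where
    \<open>K\<close> is within \<open>e / 2\<close> of its end values.\<close>
  define d where "d = min (min d0 d1) T / 4"
  have d: "d > 0" "4 * d \<le> T" "2 * d < d0" "2 * d < d1"
    using d0(1) d1(1) \<open>T > 0\<close> by (auto simp: d_def)
  define \<eta>0 where "\<eta>0 = (\<lambda>t. step ((t - d) / d))"
  define \<eta>1 where "\<eta>1 = (\<lambda>t. step ((t - (T - 2 * d)) / d))"
  define \<beta>0 where "\<beta>0 = (\<lambda>t. tent ((t - d) / d) / d)"
  define \<beta>1 where "\<beta>1 = (\<lambda>t. tent ((t - (T - 2 * d)) / d) / d)"
  have "((\<lambda>t. (t - c) / d) has_real_derivative 1 / d) (at t)" for c t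
    using d(1) by (auto intro!: derivative_eq_intros)
  from DERIV_chain2 [OF DERIV_step this]
  have D0: "(\<eta>0 has_real_derivative \<beta>0 t) (at t)" and D1: "(\<eta>1 has_real_derivative \<beta>1 t) (at t)" for t
    by (simp_all add: \<eta>0_def \<eta>1_def \<beta>0_def \<beta>1_def)
  have cont: "continuous_on S \<beta>0" "continuous_on S \<beta>1" for S
    unfolding \<beta>0_def \<beta>1_def tent_def using d by (auto intro!: continuous_intros)
  show thesis
  proof
    show "((\<lambda>t. \<eta>0 t - \<eta>1 t) has_real_derivative \<beta>0 t - \<beta>1 t) (at t)" for t
      by (intro derivative_intros D0 D1)
    show "continuous_on UNIV (\<lambda>t. \<beta>0 t - \<beta>1 t)"
      by (intro continuous_intros cont)
    show "0 \<le> \<eta>0 t - \<eta>1 t" "\<eta>0 t - \<eta>1 t \<le> 1" for t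
      using step_mono [of "(t - (T - 2 * d)) / d" "(t - d) / d"] d
        step_le_1 [of "(t - d) / d"] step_nonneg [of "(t - (T - 2 * d)) / d"]
      by (auto simp: \<eta>0_def \<eta>1_def divide_simps)
    show "0 < d" "T - d < T"
      using d by auto
    show "\<eta>0 t - \<eta>1 t = 0" if "t \<notin> {d..T - d}" for t
    proof (cases "t < d")
      case True
      then show ?thesis
        using d by (simp add: \<eta>0_def \<eta>1_def step_eq_0 divide_simps)
    next
      case False
      with that have "t > T - d"
        by simp
      then show ?thesis
        using d by (simp add: \<eta>0_def \<eta>1_def step_eq_1 divide_simps)
    qed
    \<comment> \<open>On the support of each bump \<open>K\<close> is replaced by a constant on the
      unfavourable side; off the support the bump vanishes.\<close>
    have "(LINT t:{0..T}|lborel. (\<beta>0 t - \<beta>1 t) * K t)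
        \<le> (LINT t:{0..T}|lborel. \<beta>0 t * (K 0 + e / 2) - \<beta>1 t * (K T - e / 2))"
    proof (rule set_integral_mono_continuous)
      fix t
      assume t: "t \<in> {0..T}"
      have "\<beta>0 t * K t \<le> \<beta>0 t * (K 0 + e / 2)"
      proof (cases "(t - d) / d \<in> {0..1}")
        case True
        then have "\<bar>t\<bar> < d0"
          using d by (auto simp: divide_simps)
        then have "K t \<le> K 0 + e / 2"
          using d0(2) [OF t] by linarith
        then show ?thesis
          using d(1) tent_nonneg by (intro mult_left_mono) (auto simp: \<beta>0_def)
      qed (simp add: \<beta>0_def tent_eq_0)
      moreover have "\<beta>1 t * (K T - e / 2) \<le> \<beta>1 t * K t"
      proof (cases "(t - (T - 2 * d)) / d \<in> {0..1}")
        case True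
        then have "\<bar>t - T\<bar> < d1"
          using d by (auto simp: divide_simps)
        then have "K T - e / 2 \<le> K t"
          using d1(2) [OF t] by linarith
        then show ?thesis
          using d(1) tent_nonneg by (intro mult_left_mono) (auto simp: \<beta>1_def)
      qed (simp add: \<beta>1_def tent_eq_0)
      ultimately show "(\<beta>0 t - \<beta>1 t) * K t \<le> \<beta>0 t * (K 0 + e / 2) - \<beta>1 t * (K T - e / 2)"
        by (simp add: left_diff_distrib)
    qed (intro continuous_intros cont K)+
    \<comment> \<open>With constants in place of \<open>K\<close> the primitive is explicit, and
      each step climbs from 0 at time 0 to 1 at time \<open>T\<close>.\<close>
    also have "\<dots> = (\<eta>0 T * (K 0 + e / 2) - \<eta>1 T * (K T - e / 2)) -
        (\<eta>0 0 * (K 0 + e / 2) - \<eta>1 0 * (K T - e / 2))"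
      using \<open>T > 0\<close> by (intro set_integral_FTC continuous_intros cont derivative_intros
          DERIV_cmult_right D0 D1) auto
    also have "\<dots> = K 0 - K T + e"
      using d by (simp add: \<eta>0_def \<eta>1_def step_eq_0 step_eq_1 divide_simps)
    finally show "(LINT t:{0..T}|lborel. (\<beta>0 t - \<beta>1 t) * K t) \<le> K 0 - K T + e" .
  qed
qed

section \<open>The lower bound\<close>

definition action :: "('n::finite torus \<times> real \<Rightarrow> real) \<Rightarrow> real ^ 'n \<Rightarrow> 'n torus \<Rightarrow> real \<Rightarrow> real"
  where "action \<phi> P x t =
    deriv (\<lambda>s. \<phi> (x, s)) t + 1 / 2 * (norm (torus_grad (\<lambda>y. \<phi> (y, t)) x + P))\<^sup>2"

lemma F_curve_action:
  "F_curve m P T = ereal (1 / T) *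
    (INF \<phi>\<in>C1_compact_support T. ereal (LINT t:{0..T}|lborel. LINT x|m t. action \<phi> P x t))"
  by (simp add: F_curve_def action_def)

text \<open>The chain rule along the slices \<open>(x, t)\<close> with \<open>t\<close> or
  \<open>x\<close> fixed identifies the spatial and time derivatives as the two components of the
  joint gradient, from which they inherit joint continuity.\<close>

lemma C1_space_time:
  fixes \<phi> :: "'n::finite torus \<times> real \<Rightarrow> real"
  assumes "C1_fun (\<lambda>(x, t). \<phi> (to_torus x, t))"
  defines "g \<equiv> gradient (\<lambda>(x, t). \<phi> (to_torus x, t))"
  shows C1_space_time_slice: "(\<lambda>x. \<phi> (x, t)) \<in> C1_torus"
    and C1_space_time_grad: "torus_grad (\<lambda>y. \<phi> (y, t)) (to_torus y) = fst (g (y, t))"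
    and C1_space_time_DERIV: "((\<lambda>s. \<phi> (to_torus y, s)) has_real_derivative snd (g (y, t))) (at t)"
    and C1_space_time_continuous: "continuous_on UNIV g"
proof -
  have g: "GDERIV (\<lambda>(x, t). \<phi> (to_torus x, t)) p :> g p" for p
    using assms(1) unfolding C1_fun_alt g_def by blast
  show cont: "continuous_on UNIV g"
    using assms by (simp add: C1_fun_alt)
  have x: "GDERIV (\<lambda>x. \<phi> (to_torus x, t)) y :> fst (g (y, t))" for y t
  proof -
    have "((\<lambda>x. (x, t)) has_derivative (\<lambda>h. (h, 0))) (at y)"
      by (auto intro!: derivative_eq_intros)
    from has_derivative_compose [OF this g [of "(y, t)", unfolded gderiv_def]]
    show ?thesis
      by (simp add: gderiv_def inner_prod_def)
  qed
  show "((\<lambda>s. \<phi> (to_torus y, s)) has_real_derivative snd (g (y, t))) (at t)"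
  proof -
    have "((\<lambda>s. (y, s)) has_derivative (\<lambda>h. (0, h))) (at t)"
      by (auto intro!: derivative_eq_intros)
    from has_derivative_compose [OF this g [of "(y, t)", unfolded gderiv_def]]
    show ?thesis
      by (simp add: has_field_derivative_def inner_prod_def mult_commute_abs)
  qed
  have "continuous_on UNIV (\<lambda>y. g (y, t))" for t
    by (rule continuous_on_compose2 [OF cont]) (auto intro!: continuous_intros)
  then show slice: "(\<lambda>x. \<phi> (x, t)) \<in> C1_torus" for t
    by (intro C1_torusI [OF x] continuous_on_fst)
  show "torus_grad (\<lambda>y. \<phi> (y, t)) (to_torus y) = fst (g (y, t))"
    using gradient_eqI [OF x, of t y] torus_grad_to_torus [OF slice] by simp
qed

lemma C1_space_time_deriv:
  fixes \<phi> :: "'n::finite torus \<times> real \<Rightarrow> real"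
  assumes "C1_fun (\<lambda>(x, t). \<phi> (to_torus x, t))"
  shows "((\<lambda>s. \<phi> (x, s)) has_real_derivative deriv (\<lambda>s. \<phi> (x, s)) t) (at t)"
    and "continuous_on UNIV (\<lambda>(y, t). deriv (\<lambda>s. \<phi> (to_torus y, s)) t)"
    and "continuous_on UNIV (\<lambda>(y, t). action \<phi> P (to_torus y) t)"
proof -
  define g where "g = gradient (\<lambda>(x, t). \<phi> (to_torus x, t))"
  have DERIV: "((\<lambda>s. \<phi> (to_torus y, s)) has_real_derivative snd (g (y, t))) (at t)" for y t
    unfolding g_def by (rule C1_space_time_DERIV [OF assms])
  then have d: "deriv (\<lambda>s. \<phi> (to_torus y, s)) t = snd (g (y, t))" for y t
    by (rule DERIV_imp_deriv)
  have grad: "torus_grad (\<lambda>y. \<phi> (y, t)) (to_torus y) = fst (g (y, t))" for y t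
    unfolding g_def by (rule C1_space_time_grad [OF assms])
  have g: "continuous_on UNIV g"
    unfolding g_def by (rule C1_space_time_continuous [OF assms])
  show "((\<lambda>s. \<phi> (x, s)) has_real_derivative deriv (\<lambda>s. \<phi> (x, s)) t) (at t)"
    using DERIV [of "rep_torus x" t] d [of "rep_torus x" t] unfolding to_torus_rep_torus by simp
  have "continuous_on UNIV (\<lambda>p. snd (g p))"
    by (intro continuous_on_snd g)
  then show "continuous_on UNIV (\<lambda>(y, t). deriv (\<lambda>s. \<phi> (to_torus y, s)) t)"
    by (simp only: d case_prod_unfold prod.collapse)
  have "continuous_on UNIV (\<lambda>p. snd (g p) + 1 / 2 * (norm (fst (g p) + P))\<^sup>2)"
    by (intro continuous_intros g)
  then show "continuous_on UNIV (\<lambda>(y, t). action \<phi> P (to_torus y) t)"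
    by (simp only: action_def d grad case_prod_unfold prod.collapse)
qed

lemma C1_compact_support_iff:
  "\<phi> \<in> C1_compact_support T \<longleftrightarrow> C1_fun (\<lambda>(x, t). \<phi> (to_torus x, t)) \<and>
     compact (closure {p. \<phi> p \<noteq> 0}) \<and> closure {p. \<phi> p \<noteq> 0} \<subseteq> UNIV \<times> {0<..<T}"
  unfolding C1_compact_support_def by (rule mem_Collect_eq)

lemma C1_compact_supportD:
  assumes "\<phi> \<in> C1_compact_support T"
  shows "C1_fun (\<lambda>(x, t). \<phi> (to_torus x, t))" "t \<notin> {0<..<T} \<Longrightarrow> \<phi> (x, t) = 0"
proof -
  show "C1_fun (\<lambda>(x, t). \<phi> (to_torus x, t))"
    by (rule assms [unfolded C1_compact_support_iff, THEN conjunct1])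
  have *: "closure {p. \<phi> p \<noteq> 0} \<subseteq> UNIV \<times> {0<..<T}"
    by (rule assms [unfolded C1_compact_support_iff, THEN conjunct2, THEN conjunct2])
  show "\<phi> (x, t) = 0" if "t \<notin> {0<..<T}"
  proof (rule ccontr)
    assume "\<phi> (x, t) \<noteq> 0"
    then have "(x, t) \<in> closure {p. \<phi> p \<noteq> 0}"
      by (intro subsetD [OF closure_subset] CollectI)
    with * have "(x, t) \<in> UNIV \<times> {0<..<T}"
      by (rule subsetD)
    with that show False
      by simp
  qed
qed

text \<open>Since the torus is compact, confining the support to a compact time interval inside
  \<open>{0<..<T}\<close> suffices: its closure is a closed subset of a compact product.\<close>

lemma C1_compact_supportI:
  fixes \<phi> :: "'n::finite torus \<times> real \<Rightarrow> real"
  assumes "C1_fun (\<lambda>(x, t). \<phi> (to_torus x, t))" "0 < a" "b < T" "\<And>x t. t \<notin> {a..b} \<Longrightarrow> \<phi> (x, t) = 0"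
  shows "\<phi> \<in> C1_compact_support T"
proof -
  have "{p. \<phi> p \<noteq> 0} \<subseteq> UNIV \<times> {a..b}"
  proof
    fix p
    assume "p \<in> {p. \<phi> p \<noteq> 0}"
    then have "\<phi> (fst p, snd p) \<noteq> 0"
      by simp
    with assms(4) have "snd p \<in> {a..b}"
      by metis
    then show "p \<in> UNIV \<times> {a..b}"
      by (simp add: mem_Times_iff)
  qed
  then have sub: "closure {p. \<phi> p \<noteq> 0} \<subseteq> UNIV \<times> {a..b}"
    by (rule closure_minimal) (intro closed_Times closed_UNIV closed_atLeastAtMost)
  have "compact ((UNIV :: 'n torus set) \<times> {a..b})"
    by (intro compact_Times compact_torus compact_Icc)
  then have "compact ((UNIV \<times> {a..b}) \<inter> closure {p. \<phi> p \<noteq> 0})"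
    by (rule compact_Int_closed) (rule closed_closure)
  then have "compact (closure {p. \<phi> p \<noteq> 0})"
    by (simp only: inf_absorb2 [OF sub])
  moreover have "(UNIV :: 'n torus set) \<times> {a..b} \<subseteq> UNIV \<times> {0<..<T}"
    using assms(2,3) by (intro Sigma_mono) auto
  then have "closure {p. \<phi> p \<noteq> 0} \<subseteq> UNIV \<times> {0<..<T}"
    by (rule subset_trans [OF sub])
  ultimately show ?thesis
    unfolding C1_compact_support_iff by (intro conjI assms(1))
qed

section \<open>Comparison with the constant curve\<close>

lemma F_stat_le:
  fixes \<phi> :: "'n::finite torus \<Rightarrow> real"
  assumes "\<phi> \<in> C1_torus"
  shows "F_stat \<mu> P \<le> 1 / 2 * (LINT x|\<mu>. (norm (torus_grad \<phi> x + P))\<^sup>2)"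
  unfolding F_stat_def using assms
  \<comment> \<open>The infimum is taken in the reals and needs a lower bound; 0 serves because the
    integrand is a square.\<close>
  by (intro mult_left_mono cINF_lower bdd_belowI [of _ 0]) auto

lemma F_stat_near_minimizer:
  fixes \<mu> :: "'n::finite torus measure"
  assumes "e > 0"
  obtains \<phi> where "\<phi> \<in> C1_torus" "1 / 2 * (LINT x|\<mu>. (norm (torus_grad \<phi> x + P))\<^sup>2) < F_stat \<mu> P + e"
proof -
  let ?A = "\<lambda>\<phi>. LINT x|\<mu>. (norm (torus_grad \<phi> x + P))\<^sup>2"
  \<comment> \<open>The slack \<open>2 * e\<close> becomes \<open>e\<close> under the factor
    \<open>1 / 2\<close> of \<open>F_stat\<close>.\<close>
  have "(INF \<phi>\<in>C1_torus. ?A \<phi>) < (INF \<phi>\<in>C1_torus. ?A \<phi>) + 2 * e"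
    using assms by simp
  then obtain \<phi> where "\<phi> \<in> C1_torus" "?A \<phi> < (INF \<phi>\<in>C1_torus. ?A \<phi>) + 2 * e"
    using C1_torus_const by (subst (asm) cINF_less_iff) (auto intro!: bdd_belowI [of _ 0])
  then show thesis
    by (intro that [of \<phi>]) (auto simp: F_stat_def)
qed

lemma F_stat_le_F_period:
  fixes \<mu> :: "'n::finite torus measure"
  assumes \<mu>: "\<mu> \<in> prob_measures" and "T > 0"
  shows "ereal (F_stat \<mu> P) \<le> F_period T \<mu> P"
proof -
  have "T * F_stat \<mu> P \<le> (LINT t:{0..T}|lborel. LINT x|\<mu>. action \<phi> P x t)"
    if \<phi>: "\<phi> \<in> C1_compact_support T" for \<phi>
  proof -
    note C1 = C1_compact_supportD(1) [OF \<phi>]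
    define k where "k = (\<lambda>t. LINT x|\<mu>. deriv (\<lambda>s. \<phi> (x, s)) t)"
    note cont_t = continuous_on_space_slice [OF C1_space_time_deriv(2) [OF C1]]
    have H: "((\<lambda>t. LINT x|\<mu>. \<phi> (x, t)) has_real_derivative k t) (at t)" for t
      unfolding k_def
      by (intro DERIV_integral_torus [OF \<mu>] C1_space_time_deriv(1,2) [OF C1] continuous_on_C1_torus
          C1_space_time_slice C1)
    have k: "continuous_on {0..T} k"
      unfolding k_def
      by (rule continuous_on_integral_curve [OF const_closed_curve [OF \<mu>] C1_space_time_deriv(2) [OF C1]])
    \<comment> \<open>At each time the kinetic term is at least \<open>F_stat \<mu> P\<close>,
      because the slice of \<open>\<phi>\<close> is a stationary competitor; \<open>k\<close>
      collects the time derivative.\<close>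
    have "(LINT t:{0..T}|lborel. k t + F_stat \<mu> P)
        \<le> (LINT t:{0..T}|lborel. LINT x|\<mu>. action \<phi> P x t)"
    proof (rule set_integral_mono_continuous)
      show "continuous_on {0..T} (\<lambda>t. k t + F_stat \<mu> P)"
        by (intro continuous_intros k)
      show "continuous_on {0..T} (\<lambda>t. LINT x|\<mu>. action \<phi> P x t)"
        by (rule continuous_on_integral_curve [OF const_closed_curve [OF \<mu>] C1_space_time_deriv(3) [OF C1]])
      fix t
      have "continuous_on UNIV (\<lambda>x. (norm (torus_grad (\<lambda>y. \<phi> (y, t)) x + P))\<^sup>2)"
        by (intro continuous_intros continuous_on_torus_grad C1_space_time_slice C1)
      then have "(LINT x|\<mu>. action \<phi> P x t) =
          k t + 1 / 2 * (LINT x|\<mu>. (norm (torus_grad (\<lambda>y. \<phi> (y, t)) x + P))\<^sup>2)"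
        unfolding action_def k_def
        by (simp add: integrable_continuous_torus [OF \<mu>] cont_t)
      then show "k t + F_stat \<mu> P \<le> (LINT x|\<mu>. action \<phi> P x t)"
        using F_stat_le [OF C1_space_time_slice [OF C1]] by (metis add_left_mono)
    qed
    \<comment> \<open>As \<open>k\<close> is the derivative of the integral of \<open>\<phi>\<close>
      against the fixed measure, only boundary terms remain; those containing \<open>\<phi>\<close>
      vanish by its support.\<close>
    moreover have "(LINT t:{0..T}|lborel. k t + F_stat \<mu> P) =
        ((LINT x|\<mu>. \<phi> (x, T)) + F_stat \<mu> P * T) - ((LINT x|\<mu>. \<phi> (x, 0)) + F_stat \<mu> P * 0)"
    proof (rule set_integral_FTC [where F = "\<lambda>t. (LINT x|\<mu>. \<phi> (x, t)) + F_stat \<mu> P * t"])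
      show "((\<lambda>t. (LINT x|\<mu>. \<phi> (x, t)) + F_stat \<mu> P * t) has_real_derivative k t + F_stat \<mu> P) (at t)" for t
        by (rule DERIV_add [OF H]) (auto intro!: derivative_eq_intros)
    qed (use \<open>T > 0\<close> in \<open>auto intro!: continuous_intros k\<close>)
    ultimately show ?thesis
      by (simp add: C1_compact_supportD(2) [OF \<phi>] mult.commute)
  qed
  then have "ereal (T * F_stat \<mu> P) \<le>
      (INF \<phi>\<in>C1_compact_support T. ereal (LINT t:{0..T}|lborel. LINT x|\<mu>. action \<phi> P x t))"
    by (intro INF_greatest) simp
  then have "ereal (1 / T) * ereal (T * F_stat \<mu> P) \<le> F_curve (\<lambda>_. \<mu>) P T"
    unfolding F_curve_action using \<open>T > 0\<close> by (intro ereal_mult_left_mono) auto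
  also have "\<dots> \<le> F_period T \<mu> P"
    unfolding F_period_def by (intro SUP_upper const_closed_curve \<mu>)
  finally show ?thesis
    using \<open>T > 0\<close> by simp
qed

section \<open>The upper bound\<close>

text \<open>Convexity of the squared norm: the left-hand vector is the convex combination of
  \<open>v + P\<close> and \<open>P\<close> with weights \<open>a\<close> and \<open>1 - a\<close>.
  The defect is computed exactly.\<close>

lemma norm_square_cutoff_le:
  fixes v P :: "'a::real_inner"
  assumes "0 \<le> a" "a \<le> 1"
  shows "(norm (a *\<^sub>R v + P))\<^sup>2 \<le> a * (norm (v + P))\<^sup>2 + (1 - a) * (norm P)\<^sup>2"
proof -
  have "a * (norm (v + P))\<^sup>2 + (1 - a) * (norm P)\<^sup>2 - (norm (a *\<^sub>R v + P))\<^sup>2 = a * (1 - a) * (norm v)\<^sup>2"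
    unfolding power2_norm_eq_inner
    by (simp add: inner_add_left inner_add_right inner_commute algebra_simps)
  moreover have "a * (1 - a) * (norm v)\<^sup>2 \<ge> 0"
    using assms by simp
  ultimately show ?thesis
    by linarith
qed

lemma norm_square_perturb_le:
  fixes u v :: "'a::real_normed_vector"
  assumes "norm u \<le> B" "norm v \<le> B" "0 \<le> s" "s \<le> T" "T \<le> 1"
  shows "(norm (u + s *\<^sub>R v))\<^sup>2 \<le> (norm u)\<^sup>2 + 3 * T * B\<^sup>2"
proof -
  have B: "B \<ge> 0"
    using assms(1) norm_ge_zero order_trans by blast
  have "norm (u + s *\<^sub>R v) \<le> norm u + T * B"
    using norm_triangle_ineq [of u "s *\<^sub>R v"] mult_mono [OF assms(4,2)] assms(3,4) by simp
  then have "(norm (u + s *\<^sub>R v))\<^sup>2 \<le> (norm u + T * B)\<^sup>2"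
    by (rule power_mono) simp
  also have "\<dots> = (norm u)\<^sup>2 + 2 * (T * B) * norm u + T * T * B\<^sup>2"
    by (simp add: power2_eq_square algebra_simps)
  \<comment> \<open>The cross term contributes 2 and the square term 1 to the constant 3, the latter
    because \<open>T * T \<le> T\<close> for \<open>T \<le> 1\<close>.\<close>
  also have "\<dots> \<le> (norm u)\<^sup>2 + 2 * (T * B) * B + T * 1 * B\<^sup>2"
    using assms B by (intro add_mono mult_left_mono mult_right_mono) auto
  finally show ?thesis
    by (simp add: power2_eq_square algebra_simps)
qed

section \<open>The test function and the bound for all closed curves\<close>

lemma cutoff_test_function:
  fixes \<phi>\<^sub>0 \<psi> :: "'n::finite torus \<Rightarrow> real" and P :: "real ^ 'n"
  assumes \<phi>\<^sub>0: "\<phi>\<^sub>0 \<in> C1_torus" and \<psi>: "\<psi> \<in> C1_torus"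
    and \<eta>: "\<And>t. (\<eta> has_real_derivative \<eta>' t) (at t)" "continuous_on UNIV \<eta>'"
    and supp: "0 < a" "b < T" "\<And>t. t \<notin> {a..b} \<Longrightarrow> \<eta> t = 0"
  defines "\<phi> \<equiv> \<lambda>(x, t). \<eta> t * (\<phi>\<^sub>0 x + (T - t) * \<psi> x)"
  shows cutoff_test_function_mem: "\<phi> \<in> C1_compact_support T"
    and action_cutoff_test_function: "action \<phi> P x t =
      \<eta>' t * (\<phi>\<^sub>0 x + (T - t) * \<psi> x) - \<eta> t * \<psi> x +
      1 / 2 * (norm (\<eta> t *\<^sub>R (torus_grad \<phi>\<^sub>0 x + (T - t) *\<^sub>R torus_grad \<psi> x) + P))\<^sup>2"
proof -
  \<comment> \<open>The claimed joint gradient of the lift. In the time component,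
    \<open>- \<eta> t * \<psi>\<close> comes from differentiating the factor
    \<open>T - t\<close>.\<close>
  define G where "G = (\<lambda>(x, t). (\<eta> t *\<^sub>R (torus_grad \<phi>\<^sub>0 (to_torus x) + (T - t) *\<^sub>R torus_grad \<psi> (to_torus x)),
      \<eta>' t * (\<phi>\<^sub>0 (to_torus x) + (T - t) * \<psi> (to_torus x)) - \<eta> t * \<psi> (to_torus x)))"
  have lift: "((\<lambda>p. f (to_torus (fst p))) has_derivative
      (\<lambda>h. inner (fst h) (torus_grad f (to_torus (fst p))))) (at p)"
    if "f \<in> C1_torus" for f :: "'n torus \<Rightarrow> real" and p :: "(real ^ 'n) \<times> real"
    by (rule has_derivative_compose [OF has_derivative_fst [OF has_derivative_ident]
          GDERIV_lift [OF that, unfolded gderiv_def]])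
  have \<eta>_lift: "((\<lambda>p. \<eta> (snd p)) has_derivative (\<lambda>h. \<eta>' (snd p) * snd h)) (at p)"
    for p :: "(real ^ 'n) \<times> real"
    by (rule has_derivative_compose [OF has_derivative_snd [OF has_derivative_ident]
          \<eta>(1) [unfolded has_field_derivative_def]])
  have D: "GDERIV (\<lambda>(x, t). \<phi> (to_torus x, t)) p :> G p" for p
    unfolding gderiv_def \<phi>_def G_def case_prod_unfold fst_conv snd_conv
    by (rule has_derivative_eq_rhs, (rule derivative_intros lift \<phi>\<^sub>0 \<psi> \<eta>_lift)+)
      (auto simp: fun_eq_iff inner_prod_def inner_add_right algebra_simps)
  have \<eta>_cont: "continuous_on UNIV \<eta>"
    using \<eta>(1) by (meson DERIV_isCont continuous_at_imp_continuous_on)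
  have snd_cont: "continuous_on UNIV (\<lambda>p :: (real ^ 'n) \<times> real. f (snd p))"
    if "continuous_on UNIV f" for f :: "real \<Rightarrow> real"
    by (rule continuous_on_compose2 [OF that]) (auto intro: continuous_on_snd continuous_on_id)
  have fst_cont: "continuous_on UNIV (\<lambda>p :: (real ^ 'n) \<times> real. f (to_torus (fst p)))"
    if "continuous_on UNIV f" for f :: "'n torus \<Rightarrow> 'b::real_normed_vector"
    by (rule continuous_on_compose2 [OF continuous_on_lift [OF that]])
      (auto intro: continuous_on_fst continuous_on_id)
  have "continuous_on UNIV G"
    unfolding G_def case_prod_unfold
    by (intro continuous_on_Pair continuous_on_add continuous_on_diff continuous_on_mult
        continuous_on_scaleR continuous_on_const continuous_on_snd continuous_on_id snd_cont \<eta>_cont \<eta>(2) fst_cont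
        continuous_on_torus_grad continuous_on_C1_torus \<phi>\<^sub>0 \<psi>)
  with D have C1: "C1_fun (\<lambda>(x, t). \<phi> (to_torus x, t))"
    unfolding C1_fun_def by metis
  show "\<phi> \<in> C1_compact_support T"
    by (rule C1_compact_supportI [OF C1 supp(1,2)]) (simp add: \<phi>_def supp(3))
  have G: "gradient (\<lambda>(x, t). \<phi> (to_torus x, t)) p = G p" for p
    by (rule gradient_eqI [OF D])
  obtain y where y: "x = to_torus y"
    by (metis to_torus_rep_torus)
  have "deriv (\<lambda>s. \<phi> (x, s)) t = snd (G (y, t))"
    using C1_space_time_DERIV [OF C1, of y t] unfolding G y by (rule DERIV_imp_deriv)
  moreover have "torus_grad (\<lambda>y. \<phi> (y, t)) x = fst (G (y, t))"
    using C1_space_time_grad [OF C1, of t y] unfolding G y .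
  ultimately show "action \<phi> P x t =
      \<eta>' t * (\<phi>\<^sub>0 x + (T - t) * \<psi> x) - \<eta> t * \<psi> x +
      1 / 2 * (norm (\<eta> t *\<^sub>R (torus_grad \<phi>\<^sub>0 x + (T - t) *\<^sub>R torus_grad \<psi> x) + P))\<^sup>2"
    unfolding action_def by (simp add: G_def y)
qed

text \<open>One cutoff, adapted to the curve through \<open>K\<close>, gives a competitor whose
  action is at most \<open>T\<close> times the bound. The bound involves the curve only through its
  common end \<open>\<mu>\<close>.\<close>

lemma F_period_le:
  fixes \<mu> :: "'n::finite torus measure" and P :: "real ^ 'n"
  assumes \<mu>: "\<mu> \<in> prob_measures" and T: "0 < T" "T \<le> 1" and "e > 0"
    and \<phi>\<^sub>0: "\<phi>\<^sub>0 \<in> C1_torus" and \<psi>: "\<psi> \<in> C1_torus"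
    and approx: "\<And>x. 1 / 2 * (norm (torus_grad \<phi>\<^sub>0 x + P))\<^sup>2 \<le> \<psi> x + e"
    and B: "\<And>x. norm (torus_grad \<phi>\<^sub>0 x + P) \<le> B" "\<And>x. norm (torus_grad \<psi> x) \<le> B"
  shows "F_period T \<mu> P \<le> ereal ((LINT x|\<mu>. \<psi> x) + 2 * e + 2 * T * B\<^sup>2)"
  unfolding F_period_def
proof (rule SUP_least)
  fix m
  assume m: "m \<in> closed_curves T \<mu>"
  define k where "k = (\<lambda>x t. \<phi>\<^sub>0 x + (T - t) * \<psi> x)"
  \<comment> \<open>Both ends of the curve are \<open>\<mu>\<close>, so the contributions of
    \<open>\<phi>\<^sub>0\<close> to \<open>K 0 - K T\<close> cancel and \<open>T\<close> times the
    integral of \<open>\<psi>\<close> against \<open>\<mu>\<close> remains.\<close>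
  define K where "K = (\<lambda>t. LINT x|m t. k x t)"
  \<comment> \<open>The action density at times where the test function and its derivatives
    vanish.\<close>
  define C where "C = (norm P)\<^sup>2 / 2"
  define E where "E = e + 2 * T * B\<^sup>2"
  have \<phi>\<^sub>0_cont: "continuous_on UNIV \<phi>\<^sub>0" and \<psi>_cont: "continuous_on UNIV \<psi>"
    by (intro continuous_on_C1_torus \<phi>\<^sub>0 \<psi>)+
  have K_split: "K t = (LINT x|m t. \<phi>\<^sub>0 x) + (T - t) * (LINT x|m t. \<psi> x)" if "t \<in> {0..T}" for t
    using closed_curves_prob [OF m that] \<phi>\<^sub>0_cont \<psi>_cont
    by (simp add: K_def k_def integrable_continuous_torus)
  have K_cont: "continuous_on {0..T} K"
    by (rule continuous_on_eq [OF _ K_split [symmetric]])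
      (intro continuous_intros closed_curves_continuous [OF m] \<phi>\<^sub>0_cont \<psi>_cont)
  \<comment> \<open>The summand \<open>C t\<close> absorbs the error \<open>C (1 - \<eta>)\<close> of the cutoff, since \<open>1 - \<eta> - t \<eta>'\<close> has the
    primitive \<open>t - t \<eta>\<close>.\<close>
  then have "continuous_on {0..T} (\<lambda>t. K t + C * t)" "T * e > 0"
    using T \<open>e > 0\<close> by (auto intro!: continuous_intros)
  \<comment> \<open>The tolerance \<open>T * e\<close> becomes \<open>e\<close> after the final
    division by \<open>T\<close>; with the \<open>e\<close> inside \<open>E\<close> it makes up
    \<open>2 * e\<close>.\<close>
  then obtain \<eta> \<eta>' a b where \<eta>: "\<And>t. (\<eta> has_real_derivative \<eta>' t) (at t)" "continuous_on UNIV \<eta>'"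
    and \<eta>_range: "\<And>t. 0 \<le> \<eta> t" "\<And>t. \<eta> t \<le> 1"
    and supp: "0 < a" "b < T" "\<And>t. t \<notin> {a..b} \<Longrightarrow> \<eta> t = 0"
    and \<eta>K: "(LINT t:{0..T}|lborel. \<eta>' t * (K t + C * t)) \<le> K 0 + C * 0 - (K T + C * T) + T * e"
    using cutoff [of T "T * e" "\<lambda>t. K t + C * t"] T(1) by blast
  have \<eta>_cont: "continuous_on {0..T} \<eta>" "continuous_on {0..T} \<eta>'"
    using \<eta> by (auto intro: DERIV_continuous_on continuous_on_subset has_field_derivative_at_within)
  define \<phi> where "\<phi> = (\<lambda>(x, t). \<eta> t * (\<phi>\<^sub>0 x + (T - t) * \<psi> x))"
  have \<phi>: "\<phi> \<in> C1_compact_support T"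
    unfolding \<phi>_def by (rule cutoff_test_function_mem [OF \<phi>\<^sub>0 \<psi> \<eta> supp])
  note C1 = C1_compact_supportD(1) [OF \<phi>]
  \<comment> \<open>Convexity removes the factor \<open>\<eta> t\<close> from the gradient, the term
    with \<open>T - t\<close> costs \<open>O(T)\<close>, and \<open>approx\<close> trades the
    remaining density for \<open>\<psi>\<close>. The resulting \<open>\<eta> t * \<psi> x\<close>
    cancels the one from the time derivative.\<close>
  have action_le: "action \<phi> P x t \<le> \<eta>' t * k x t + (E + C * (1 - \<eta> t))" if t: "t \<in> {0..T}" for x t
  proof -
    let ?v = "torus_grad \<phi>\<^sub>0 x + (T - t) *\<^sub>R torus_grad \<psi> x"
    have "(norm (\<eta> t *\<^sub>R ?v + P))\<^sup>2 \<le> \<eta> t * (norm (?v + P))\<^sup>2 + (1 - \<eta> t) * (norm P)\<^sup>2"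
      by (intro norm_square_cutoff_le \<eta>_range)
    also have "(norm (?v + P))\<^sup>2 \<le> (norm (torus_grad \<phi>\<^sub>0 x + P))\<^sup>2 + 3 * T * B\<^sup>2"
      using norm_square_perturb_le [OF B, of "T - t" T x x] t T by (simp add: ac_simps)
    also have "\<dots> \<le> 2 * (\<psi> x + e) + 3 * T * B\<^sup>2"
      using approx [of x] by simp
    finally have "(norm (\<eta> t *\<^sub>R ?v + P))\<^sup>2
        \<le> \<eta> t * (2 * (\<psi> x + e) + 3 * T * B\<^sup>2) + (1 - \<eta> t) * (norm P)\<^sup>2"
      using \<eta>_range(1) by (simp add: mult_left_mono)
    then have "1 / 2 * (norm (\<eta> t *\<^sub>R ?v + P))\<^sup>2
        \<le> \<eta> t * \<psi> x + \<eta> t * (e + 3 / 2 * T * B\<^sup>2) + C * (1 - \<eta> t)"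
      by (simp add: C_def field_simps)
    \<comment> \<open>Here \<open>\<eta> t \<le> 1\<close>, and the coefficient \<open>3 / 2\<close>
      is rounded up to the 2 in \<open>E\<close>.\<close>
    moreover have "\<eta> t * (e + 3 / 2 * T * B\<^sup>2) \<le> 1 * E"
      unfolding E_def using \<eta>_range T \<open>e > 0\<close> by (intro mult_mono) auto
    ultimately show ?thesis
      using action_cutoff_test_function [OF \<phi>\<^sub>0 \<psi> \<eta> supp, of P x t]
      unfolding \<phi>_def k_def by linarith
  qed
  have "(LINT t:{0..T}|lborel. LINT x|m t. action \<phi> P x t)
      \<le> (LINT t:{0..T}|lborel. \<eta>' t * (K t + C * t) + (E + C * (1 - \<eta> t - t * \<eta>' t)))"
  proof (rule set_integral_mono_continuous)
    show "continuous_on {0..T} (\<lambda>t. LINT x|m t. action \<phi> P x t)"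
      by (rule continuous_on_integral_curve [OF m C1_space_time_deriv(3) [OF C1]])
    show "continuous_on {0..T} (\<lambda>t. \<eta>' t * (K t + C * t) + (E + C * (1 - \<eta> t - t * \<eta>' t)))"
      by (intro continuous_intros K_cont \<eta>_cont)
    fix t
    assume t: "t \<in> {0..T}"
    note mt = closed_curves_prob [OF m t]
    interpret prob_space "m t"
      using prob_measuresD(1) [OF mt] .
    have k: "continuous_on UNIV (\<lambda>x. k x t)"
      unfolding k_def by (intro continuous_intros \<phi>\<^sub>0_cont \<psi>_cont)
    have "(LINT x|m t. action \<phi> P x t) \<le> (LINT x|m t. \<eta>' t * k x t + (E + C * (1 - \<eta> t)))"
      by (intro integral_mono integrable_continuous_torus [OF mt] action_le [OF t] continuous_intros k
          continuous_on_space_slice [OF C1_space_time_deriv(3) [OF C1]])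
    also have "\<dots> = \<eta>' t * K t + (E + C * (1 - \<eta> t))"
      by (simp add: K_def integrable_continuous_torus [OF mt k] prob_space)
    also have "\<dots> = \<eta>' t * (K t + C * t) + (E + C * (1 - \<eta> t - t * \<eta>' t))"
      by (simp add: algebra_simps)
    finally show "(LINT x|m t. action \<phi> P x t) \<le>
        \<eta>' t * (K t + C * t) + (E + C * (1 - \<eta> t - t * \<eta>' t))" .
  qed
  also have "\<dots> = (LINT t:{0..T}|lborel. \<eta>' t * (K t + C * t)) +
      (LINT t:{0..T}|lborel. E + C * (1 - \<eta> t - t * \<eta>' t))"
  proof (rule set_integral_add)
    show "set_integrable lborel {0..T} (\<lambda>t. \<eta>' t * (K t + C * t))"
      "set_integrable lborel {0..T} (\<lambda>t. E + C * (1 - \<eta> t - t * \<eta>' t))"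
      by (auto intro!: continuous_on_integrable_interval continuous_intros K_cont \<eta>_cont)
  qed
  also have "(LINT t:{0..T}|lborel. E + C * (1 - \<eta> t - t * \<eta>' t)) =
      (E * T + C * (T - T * \<eta> T)) - (E * 0 + C * (0 - 0 * \<eta> 0))"
  proof (rule set_integral_FTC [where F = "\<lambda>t. E * t + C * (t - t * \<eta> t)"])
    show "((\<lambda>t. E * t + C * (t - t * \<eta> t)) has_real_derivative E + C * (1 - \<eta> t - t * \<eta>' t)) (at t)" for t
      by (auto intro!: derivative_eq_intros \<eta>(1) simp: algebra_simps)
    show "continuous_on {0..T} (\<lambda>t. E + C * (1 - \<eta> t - t * \<eta>' t))"
      by (intro continuous_intros \<eta>_cont)
  qed (use T in simp)
  also have "\<eta> T = 0"
    using supp by simp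
  also note \<eta>K
  \<comment> \<open>The boundary term \<open>- C * T\<close> from the cutoff estimate cancels the
    \<open>C * T\<close> produced by the primitive.\<close>
  also have "K 0 + C * 0 - (K T + C * T) + T * e + (E * T + C * (T - T * 0) - (E * 0 + C * (0 - 0 * \<eta> 0)))
      = T * ((LINT x|\<mu>. \<psi> x) + 2 * e + 2 * T * B\<^sup>2)"
    using T K_split [of 0] K_split [of T] closed_curves_ends [OF m] by (simp add: E_def algebra_simps)
  finally have "(LINT t:{0..T}|lborel. LINT x|m t. action \<phi> P x t)
      \<le> T * ((LINT x|\<mu>. \<psi> x) + 2 * e + 2 * T * B\<^sup>2)"
    by simp
  then have "(INF \<phi>\<in>C1_compact_support T. ereal (LINT t:{0..T}|lborel. LINT x|m t. action \<phi> P x t))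
      \<le> ereal (T * ((LINT x|\<mu>. \<psi> x) + 2 * e + 2 * T * B\<^sup>2))"
    by (intro INF_lower2 [OF \<phi>]) simp
  then have "F_curve m P T \<le> ereal (1 / T) * ereal (T * ((LINT x|\<mu>. \<psi> x) + 2 * e + 2 * T * B\<^sup>2))"
    unfolding F_curve_action using T by (intro ereal_mult_left_mono) auto
  then show "F_curve m P T \<le> ereal ((LINT x|\<mu>. \<psi> x) + 2 * e + 2 * T * B\<^sup>2)"
    using T by simp
qed

section \<open>Passage to the limit\<close>

theorem corollary4p2:
  fixes \<mu> :: "'n::finite torus measure" and P :: "real ^ 'n"
  assumes "\<mu> \<in> prob_measures"
  shows "((\<lambda>T. F_period T \<mu> P) \<longlongrightarrow> ereal (F_stat \<mu> P)) (at_right 0)"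
proof (rule order_tendstoI)
  fix c
  assume "c < ereal (F_stat \<mu> P)"
  then have "c < F_period T \<mu> P" if "T > 0" for T
    using F_stat_le_F_period [OF assms that] by (rule less_le_trans)
  then show "eventually (\<lambda>T. c < F_period T \<mu> P) (at_right 0)"
    by (rule eventually_mono [OF eventually_at_right_less])
next
  fix c
  assume "ereal (F_stat \<mu> P) < c"
  \<comment> \<open>The bound \<open>c\<close> may be infinite, so the error budget is measured
    against a real \<open>r\<close> below it.\<close>
  then obtain r where r: "F_stat \<mu> P < r" "ereal r < c"
    using ereal_dense2 by (metis less_ereal.simps(1))
  \<comment> \<open>Five shares: one for the near-minimiser, one for replacing the density by
    \<open>\<psi>\<close>, two from \<open>F_period_le\<close>, and one for the term linear in
    \<open>T\<close>.\<close>
  define e where "e = (r - F_stat \<mu> P) / 5"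
  have "e > 0"
    using r by (simp add: e_def)
  obtain \<phi>\<^sub>0 where \<phi>\<^sub>0: "\<phi>\<^sub>0 \<in> C1_torus"
    and \<phi>\<^sub>0_min: "1 / 2 * (LINT x|\<mu>. (norm (torus_grad \<phi>\<^sub>0 x + P))\<^sup>2) < F_stat \<mu> P + e"
    using F_stat_near_minimizer [OF \<open>e > 0\<close>] by blast
  have grad: "continuous_on UNIV (\<lambda>x. torus_grad \<phi>\<^sub>0 x + P)"
    by (intro continuous_intros continuous_on_torus_grad \<phi>\<^sub>0)
  have density: "continuous_on UNIV (\<lambda>x. 1 / 2 * (norm (torus_grad \<phi>\<^sub>0 x + P))\<^sup>2)"
    by (intro continuous_intros continuous_on_torus_grad \<phi>\<^sub>0)
  obtain \<psi> where \<psi>: "\<psi> \<in> C1_torus"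
    and approx: "\<And>x. \<bar>1 / 2 * (norm (torus_grad \<phi>\<^sub>0 x + P))\<^sup>2 - \<psi> x\<bar> < e"
    using C1_torus_dense [OF density \<open>e > 0\<close>] by blast
  obtain B0 B1 where "\<And>x. norm (torus_grad \<phi>\<^sub>0 x + P) \<le> B0" "\<And>x. norm (torus_grad \<psi> x) \<le> B1"
    using continuous_on_torus_bounded [OF grad]
      continuous_on_torus_bounded [OF continuous_on_torus_grad [OF \<psi>]] by blast
  then have B: "norm (torus_grad \<phi>\<^sub>0 x + P) \<le> max B0 B1" "norm (torus_grad \<psi> x) \<le> max B0 B1" for x
    by (auto simp: le_max_iff_disj)
  interpret prob_space \<mu>
    using prob_measuresD(1) [OF assms] .
  have "(LINT x|\<mu>. \<psi> x) \<le> (LINT x|\<mu>. 1 / 2 * (norm (torus_grad \<phi>\<^sub>0 x + P))\<^sup>2 + e)"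
  proof (rule integral_mono)
    show "\<psi> x \<le> 1 / 2 * (norm (torus_grad \<phi>\<^sub>0 x + P))\<^sup>2 + e" for x
      using approx [of x] by linarith
  qed (intro integrable_continuous_torus [OF assms] continuous_on_C1_torus \<psi> continuous_on_add
      continuous_on_const density)+
  also have "\<dots> = 1 / 2 * (LINT x|\<mu>. (norm (torus_grad \<phi>\<^sub>0 x + P))\<^sup>2) + e"
    using integrable_continuous_torus [OF assms density] by (simp add: prob_space)
  finally have \<psi>_le: "(LINT x|\<mu>. \<psi> x) < F_stat \<mu> P + 2 * e"
    using \<phi>\<^sub>0_min by linarith
  \<comment> \<open>The functions \<open>\<phi>\<^sub>0\<close> and \<open>\<psi>\<close> and their
    bounds were fixed before \<open>T\<close>, so this error vanishes in the limit.\<close>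
  have "((\<lambda>T. 2 * T * (max B0 B1)\<^sup>2) \<longlongrightarrow> 2 * 0 * (max B0 B1)\<^sup>2) (at_right 0)"
    by (intro tendsto_intros)
  then have "eventually (\<lambda>T. 2 * T * (max B0 B1)\<^sup>2 < e) (at_right 0)"
    by (rule order_tendstoD) (use \<open>e > 0\<close> in simp)
  moreover have "eventually (\<lambda>T. T \<in> {0<..<1}) (at_right (0::real))"
    by (rule eventually_at_right_real) simp
  ultimately show "eventually (\<lambda>T. F_period T \<mu> P < c) (at_right 0)"
  proof eventually_elim
    case (elim T)
    have "F_period T \<mu> P \<le> ereal ((LINT x|\<mu>. \<psi> x) + 2 * e + 2 * T * (max B0 B1)\<^sup>2)"
    proof (rule F_period_le [OF assms _ _ \<open>e > 0\<close> \<phi>\<^sub>0 \<psi> _ B])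
      show "1 / 2 * (norm (torus_grad \<phi>\<^sub>0 x + P))\<^sup>2 \<le> \<psi> x + e" for x
        using approx [of x] by linarith
    qed (use elim in auto)
    also have "\<dots> \<le> ereal r"
      using \<psi>_le elim(1) by (simp add: e_def field_simps)
    also have "\<dots> < c"
      by (rule r(2))
    finally show ?case .
  qed
qed

end
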